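(* Let $N$ be a timelike ruled surface of type $N_-$ in $\mathbb{R}_1^3$ with timelike striction curve $\vec c$ and curvatures $k_1,k_2$, and let $N^\gamma$ be a $\gamma$-transversal surface of $N$ with ruling $\vec q_\gamma=\mu\vec q+\eta\vec a$ whose striction curve $\vec c_\gamma$ coincides with $\vec c$. Let $\gamma$ be non-constant. Then $\vec c$ is a line of curvature on $N$ if and only if $$\frac{k_2}{k_1}=\frac{\eta}{\mu}$$ holds.
   Context: $\mathbb{R}_1^3$ is Minkowski 3-space with metric $\langle\cdot,\cdot\rangle=-dx_1^2+dx_2^2+dx_3^2$. A nonzero vector $\vec v$ is timelike if $\langle\vec v,\vec v\rangle<0$, null if $\langle\vec v,\vec v\rangle=0$, spacelike if $\langle\vec v,\vec v\rangle>0$. Setting. All functions are smooth on an open interval $I$, and equations between functions are identities on $I$. A timelike ruled surface of type $N_-$ with timelike striction curve is $\vec r(s,v)=\vec c(s)+v\vec q(s)$, with ruling direction $\vec q$ unit timelike, where $\vec c$ is its striction curve, a timelike curve parametrized by arc length $s$. It has a Frenet frame $\{\vec q,\vec h,\vec a\}$ of mutually orthogonal vectors, $\langle\vec q,\vec q\rangle=-1$, $\langle\vec h,\vec h\rangle=\langle\vec a,\vec a\rangle=1$ ($\vec h$ is the central normal, i.e. the surface normal along $\vec c$; $\vec a$ the central tangent), with $\vec q\,'=k_1\vec h$, $\vec h'=k_1\vec q+k_2\vec a$, $\vec a'=-k_2\vec h$ (prime is $d/ds$) for functions $k_1,k_2$. Standing assumption: the frame vectors and their derivatives are non-null, and $\vec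 q\,'\neq0$ (i.e. $k_1\neq0$). The unit tangent of $\vec c$ is $\vec c\,'=\vec t=\cosh\theta\,\vec q+\sinh\theta\,\vec a$ for a real function $\theta$ (the hyperbolic angle between $\vec t$ and $\vec q$). $\gamma$-transversal surface. For a function $\gamma:I\to\mathbb{R}$, $N^\gamma$ is the ruled surface $\vec r_\gamma(s,v)=\vec c(s)+v\vec q_\gamma(s)$ with $\vec q_\gamma=\mu\vec q+\eta\vec a$, where $(\mu,\eta)=(\cosh\gamma,\sinh\gamma)$ if $\vec q_\gamma$ is timelike and $(\mu,\eta)=(\sinh\gamma,\cosh\gamma)$ if $\vec q_\gamma$ is spacelike; it is assumed that $\mu\ne0$ and $\eta\neq0$. Its striction curve is $\vec c_\gamma=\vec c+v_\gamma\vec q_\gamma$ with strictional distance $v_\gamma=-\langle\vec c\,',\vec q_\gamma'\rangle/\langle\vec q_\gamma',\vec q_\gamma'\rangle$ (this formula presupposes a nonzero denominator); it coincides with $\vec c$ if $v_\gamma=0$. The curve $\vec c$ is a line of curvature on $N$ if $\vec h'$ and $\vec t$ are linearly dependent, i.e. $\vec h'=\lambda\vec t$ for some scalar function $\lambda=\lambda(s)$.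
   Formalization: "γ non-constant" is taken to mean that γ is constant on no nonempty open subinterval of I; if γ is merely non-constant on I the claim fails, since where γ is constant the condition that the striction curves coincide does not determine θ. *)

theory Defs
  imports "HOL-Analysis.Analysis"
begin

section \<open>Minkowski 3-space\<close>

definition mink :: "real^3 \<Rightarrow> real^3 \<Rightarrow> real" where
  "mink x y = - (x$1 * y$1) + x$2 * y$2 + x$3 * y$3"

text \<open>The causal character is defined for nonzero vectors only, so the zero vector is
  neither timelike, null nor spacelike.\<close>

definition timelike :: "real^3 \<Rightarrow> bool" where
  "timelike x \<longleftrightarrow> x \<noteq> 0 \<and> mink x x < 0"

definition null_vec :: "real^3 \<Rightarrow> bool" where
  "null_vec x \<longleftrightarrow> x \<noteq> 0 \<and> mink x x = 0"

definition spacelike :: "real^3 \<Rightarrow> bool" where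
  "spacelike x \<longleftrightarrow> x \<noteq> 0 \<and> mink x x > 0"


section \<open>Smooth functions of one real variable\<close>

definition vderiv :: "(real \<Rightarrow> 'a::real_normed_vector) \<Rightarrow> real \<Rightarrow> 'a" where
  "vderiv f s = vector_derivative f (at s)"

text \<open>Used for open \<open>I\<close> only; then it depends only on the values of \<open>f\<close> on \<open>I\<close>.\<close>

definition smooth_on :: "real set \<Rightarrow> (real \<Rightarrow> 'a::real_normed_vector) \<Rightarrow> bool" where
  "smooth_on I f \<longleftrightarrow> (\<forall>n. \<forall>s\<in>I. (vderiv ^^ n) f differentiable (at s))"


section \<open>Ruled surfaces\<close>

definition ruled_surface ::
  "(real \<Rightarrow> real^3) \<Rightarrow> (real \<Rightarrow> real^3) \<Rightarrow> real \<Rightarrow> real \<Rightarrow> real^3" where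
  "ruled_surface b d s v = b s + v *\<^sub>R d s"

text \<open>The first fundamental form is Lorentzian at every regular point, i.e. at every point where
  the two partial derivatives are linearly independent.\<close>

definition timelike_surface :: "real set \<Rightarrow> (real \<Rightarrow> real \<Rightarrow> real^3) \<Rightarrow> bool" where
  "timelike_surface I r \<longleftrightarrow> (\<forall>s\<in>I. \<forall>v.
     let X = vderiv (\<lambda>u. r u v) s; Y = vderiv (\<lambda>w. r s w) v
     in (\<forall>x y. x *\<^sub>R X + y *\<^sub>R Y = 0 \<longrightarrow> x = 0 \<and> y = 0)
        \<longrightarrow> mink X X * mink Y Y - (mink X Y)\<^sup>2 < 0)"

text \<open>Strictional distance and striction curve of the ruled surface with base curve \<open>b\<close> and
  ruling \<open>d\<close>; meaningful only where \<open>mink (vderiv d s) (vderiv d s) \<noteq> 0\<close>.\<close>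

definition striction_distance ::
  "(real \<Rightarrow> real^3) \<Rightarrow> (real \<Rightarrow> real^3) \<Rightarrow> real \<Rightarrow> real" where
  "striction_distance b d s = - mink (vderiv b s) (vderiv d s) / mink (vderiv d s) (vderiv d s)"

definition striction_curve ::
  "(real \<Rightarrow> real^3) \<Rightarrow> (real \<Rightarrow> real^3) \<Rightarrow> real \<Rightarrow> real^3" where
  "striction_curve b d s = b s + striction_distance b d s *\<^sub>R d s"

text \<open>The timelike ruled surface \<open>ruled_surface c q\<close> of type \<open>N\<^sub>-\<close> (timelike ruling) with timelike
  striction curve \<open>c\<close>, arc length parameter, frame \<open>q, h, a\<close>, curvatures \<open>k1, k2\<close>, and
  hyperbolic angle \<open>\<theta>\<close> between \<open>c'\<close> and \<open>q\<close>.\<close>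

definition ruled_surface_Nminus ::
  "real set \<Rightarrow> (real \<Rightarrow> real^3) \<Rightarrow> (real \<Rightarrow> real^3) \<Rightarrow> (real \<Rightarrow> real^3) \<Rightarrow> (real \<Rightarrow> real^3)
   \<Rightarrow> (real \<Rightarrow> real) \<Rightarrow> (real \<Rightarrow> real) \<Rightarrow> (real \<Rightarrow> real) \<Rightarrow> bool" where
  "ruled_surface_Nminus I c q h a k1 k2 \<theta> \<longleftrightarrow>
     open I \<and> is_interval I \<and> I \<noteq> {} \<and>
     smooth_on I c \<and> smooth_on I q \<and> smooth_on I h \<and> smooth_on I a \<and>
     smooth_on I k1 \<and> smooth_on I k2 \<and> smooth_on I \<theta> \<and>
     timelike_surface I (ruled_surface c q) \<and>
     (\<forall>s\<in>I.
       mink (q s) (q s) = -1 \<and> mink (h s) (h s) = 1 \<and> mink (a s) (a s) = 1 \<and>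
       mink (q s) (h s) = 0 \<and> mink (q s) (a s) = 0 \<and> mink (h s) (a s) = 0 \<and>
       vderiv q s = k1 s *\<^sub>R h s \<and>
       vderiv h s = k1 s *\<^sub>R q s + k2 s *\<^sub>R a s \<and>
       vderiv a s = - k2 s *\<^sub>R h s \<and>
       \<not> null_vec (q s) \<and> \<not> null_vec (h s) \<and> \<not> null_vec (a s) \<and>
       \<not> null_vec (vderiv q s) \<and> \<not> null_vec (vderiv h s) \<and> \<not> null_vec (vderiv a s) \<and>
       vderiv q s \<noteq> 0 \<and>
       striction_curve c q s = c s \<and>
       timelike (vderiv c s) \<and> mink (vderiv c s) (vderiv c s) = -1 \<and>
       vderiv c s = cosh (\<theta> s) *\<^sub>R q s + sinh (\<theta> s) *\<^sub>R a s)"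


section \<open>Transversal surfaces and lines of curvature\<close>

definition transversal_ruling ::
  "(real \<Rightarrow> real^3) \<Rightarrow> (real \<Rightarrow> real^3) \<Rightarrow> (real \<Rightarrow> real) \<Rightarrow> (real \<Rightarrow> real) \<Rightarrow> real \<Rightarrow> real^3" where
  "transversal_ruling q a \<mu> \<eta> s = \<mu> s *\<^sub>R q s + \<eta> s *\<^sub>R a s"

text \<open>\<open>\<mu>, \<eta>\<close> are the coefficients of the ruling of the \<open>\<gamma>\<close>-transversal surface
  \<open>ruled_surface c (transversal_ruling q a \<mu> \<eta>)\<close>. Since the ruling is continuous and nowhere null
  on the interval \<open>I\<close>, its causal character is constant there.\<close>

definition transversal_coeffs ::
  "real set \<Rightarrow> (real \<Rightarrow> real^3) \<Rightarrow> (real \<Rightarrow> real^3) \<Rightarrow> (real \<Rightarrow> real)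
   \<Rightarrow> (real \<Rightarrow> real) \<Rightarrow> (real \<Rightarrow> real) \<Rightarrow> bool" where
  "transversal_coeffs I q a \<gamma> \<mu> \<eta> \<longleftrightarrow>
     smooth_on I \<gamma> \<and>
     ((\<forall>s\<in>I. timelike (transversal_ruling q a \<mu> \<eta> s) \<and>
             \<mu> s = cosh (\<gamma> s) \<and> \<eta> s = sinh (\<gamma> s)) \<or>
      (\<forall>s\<in>I. spacelike (transversal_ruling q a \<mu> \<eta> s) \<and>
             \<mu> s = sinh (\<gamma> s) \<and> \<eta> s = cosh (\<gamma> s))) \<and>
     (\<forall>s\<in>I. \<mu> s \<noteq> 0 \<and> \<eta> s \<noteq> 0)"

definition striction_curve_coincides ::
  "real set \<Rightarrow> (real \<Rightarrow> real^3) \<Rightarrow> (real \<Rightarrow> real^3) \<Rightarrow> bool" where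
  "striction_curve_coincides I b d \<longleftrightarrow>
     (\<forall>s\<in>I. mink (vderiv d s) (vderiv d s) \<noteq> 0 \<and> striction_curve b d s = b s)"

text \<open>Merely excluding that \<open>\<gamma>\<close> is constant on all of \<open>I\<close> is not enough for smooth functions: on a
  subinterval where \<open>\<gamma>\<close> is constant the strictional distance \<open>v\<^sub>\<gamma>\<close> vanishes whatever the angle
  \<open>\<theta>\<close> is, so the direction of \<open>c'\<close> is not controlled there. Hence non-constancy is understood
  on every subinterval. Isolated zeros of \<open>\<gamma>'\<close> remain allowed.\<close>

definition nonconstant :: "real set \<Rightarrow> (real \<Rightarrow> real) \<Rightarrow> bool" where
  "nonconstant I f \<longleftrightarrow> (\<forall>x y. x < y \<and> {x<..<y} \<subseteq> I \<longrightarrow> \<not> f constant_on {x<..<y})"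

definition line_of_curvature ::
  "real set \<Rightarrow> (real \<Rightarrow> real^3) \<Rightarrow> (real \<Rightarrow> real^3) \<Rightarrow> bool" where
  "line_of_curvature I c h \<longleftrightarrow>
     (\<exists>l :: real \<Rightarrow> real. smooth_on I l \<and> (\<forall>s\<in>I. vderiv h s = l s *\<^sub>R vderiv c s))"

end

theory Submission
  imports Defs
begin

text \<open>Vanishing of the strictional distance means \<open>\<langle>c', q\<^sub>\<gamma>'\<rangle> = 0\<close>. For a timelike ruling the left side
  is \<open>\<gamma>' sinh (\<theta> - \<gamma>)\<close>, for a spacelike one it is \<open>- \<gamma>' cosh (\<theta> - \<gamma>)\<close>. As \<open>\<gamma>\<close> is constant on no
  subinterval, the other factor vanishes on a dense set, hence everywhere by continuity: the
  spacelike case is impossible, and in the timelike case \<open>\<theta> = \<gamma>\<close>, so that \<open>c' = q\<^sub>\<gamma>\<close>. Now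
  \<open>h' = k1 q + k2 a\<close> is proportional to \<open>c' = \<mu> q + \<eta> a\<close> iff \<open>k2 / k1 = \<eta> / \<mu>\<close>, and then the factor of
  proportionality is \<open>- \<langle>h', c'\<rangle>\<close>, which is smooth.\<close>

section \<open>Calculus of curves: higher derivatives, smoothness, cancellation\<close>

lemma bounded_bilinear_mink: "bounded_bilinear mink"
  unfolding bilinear_conv_bounded_bilinear[symmetric] bilinear_def mink_def
  by (auto intro!: linearI simp: algebra_simps)

lemma vderiv_eqI: "(f has_vector_derivative D) (at s) \<Longrightarrow> vderiv f s = D"
  unfolding vderiv_def by (rule vector_derivative_at)

lemma has_vector_derivative_vderiv:
  "f differentiable at s \<Longrightarrow> (f has_vector_derivative vderiv f s) (at s)"
  unfolding vderiv_def by (simp add: vector_derivative_works)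

lemma vderiv_cong:
  assumes "open I" "s \<in> I" "\<And>u. u \<in> I \<Longrightarrow> f u = g u"
  shows "vderiv f s = vderiv g s"
proof -
  have "(f has_vector_derivative D) (at s) \<longleftrightarrow> (g has_vector_derivative D) (at s)" for D
    using has_vector_derivative_transform_within_open[of f D s I g]
      has_vector_derivative_transform_within_open[of g D s I f] assms
    by auto
  then show ?thesis
    by (simp add: vderiv_def vector_derivative_def)
qed

lemma differentiable_cong_open:
  fixes f g :: "real \<Rightarrow> 'a::real_normed_vector"
  assumes "open I" "s \<in> I" "\<And>u. u \<in> I \<Longrightarrow> f u = g u" "g differentiable at s"
  shows "f differentiable at s"
proof -
  have "(f has_vector_derivative vderiv g s) (at s)"
    using assms
    by (intro has_vector_derivative_transform_within_open
        [OF has_vector_derivative_vderiv[OF assms(4)] assms(1,2)]) auto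
  then show ?thesis by (rule differentiableI_vector)
qed

lemma vderiv_funpow_cong:
  assumes "open I" "s \<in> I" "\<And>u. u \<in> I \<Longrightarrow> f u = g u"
  shows "(vderiv ^^ n) f s = (vderiv ^^ n) g s"
  using assms(2)
proof (induction n arbitrary: s)
  case 0
  then show ?case using assms(3) by simp
next
  case (Suc n)
  then show ?case
    using vderiv_cong[OF assms(1), of s "(vderiv ^^ n) f" "(vderiv ^^ n) g"] by simp
qed

text \<open>Differentiability is asked only of orders below \<open>n\<close>, since the
  \<open>n\<close>-th derivative of the sum comes from differentiating order \<open>n - 1\<close>.
  This makes the lemma usable inside an induction on the order, where the summands are not yet known
  to be smooth.\<close>

lemma vderiv_funpow_add:
  fixes f g :: "real \<Rightarrow> 'a::real_normed_vector"
  assumes "open I" "s \<in> I"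
    and "\<And>m u. m < n \<Longrightarrow> u \<in> I \<Longrightarrow> (vderiv ^^ m) f differentiable at u"
    and "\<And>m u. m < n \<Longrightarrow> u \<in> I \<Longrightarrow> (vderiv ^^ m) g differentiable at u"
  shows "(vderiv ^^ n) (\<lambda>u. f u + g u) s = (vderiv ^^ n) f s + (vderiv ^^ n) g s"
  using assms(2-)
proof (induction n arbitrary: s)
  case 0
  then show ?case by simp
next
  case (Suc n)
  have "vderiv ((vderiv ^^ n) (\<lambda>u. f u + g u)) s
      = vderiv (\<lambda>u. (vderiv ^^ n) f u + (vderiv ^^ n) g u) s"
    using Suc by (intro vderiv_cong[OF assms(1)]) auto
  also have "\<dots> = vderiv ((vderiv ^^ n) f) s + vderiv ((vderiv ^^ n) g) s"
    using Suc.prems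
    by (intro vderiv_eqI has_vector_derivative_add has_vector_derivative_vderiv) auto
  finally show ?case by simp
qed

lemma smooth_on_vderiv:
  assumes "smooth_on I f"
  shows "smooth_on I (vderiv f)"
proof -
  have "(vderiv ^^ n) (vderiv f) = (vderiv ^^ Suc n) f" for n
    by (simp add: funpow_swap1)
  then show ?thesis
    using assms unfolding smooth_on_def by (simp del: funpow.simps)
qed

lemma smooth_on_differentiable: "smooth_on I f \<Longrightarrow> s \<in> I \<Longrightarrow> f differentiable at s"
  unfolding smooth_on_def by (drule spec[of _ 0]) simp

text \<open>By the Leibniz rule the derivative is \<open>B f g' + B f' g\<close>: two terms of the
  same shape with smooth arguments. Hence strong induction on the order, with \<open>f\<close> and
  \<open>g\<close> arbitrary.\<close>

lemma smooth_on_bilinear: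
  fixes f :: "real \<Rightarrow> 'a::real_normed_vector" and g :: "real \<Rightarrow> 'b::real_normed_vector"
    and B :: "'a \<Rightarrow> 'b \<Rightarrow> 'c::real_normed_vector"
  assumes "bounded_bilinear B" "open I" "smooth_on I f" "smooth_on I g"
  shows "smooth_on I (\<lambda>s. B (f s) (g s))"
proof -
  have "(vderiv ^^ n) (\<lambda>u. B (f u) (g u)) differentiable at s" if "s \<in> I" for n s
    using assms(3,4) that
  proof (induction n arbitrary: f g s rule: less_induct)
    case (less n)
    have der: "((\<lambda>u. B (f u) (g u)) has_vector_derivative
        B (f u) (vderiv g u) + B (vderiv f u) (g u)) (at u)" if "u \<in> I" for u
      by (intro bounded_bilinear.has_vector_derivative[OF assms(1)]
          has_vector_derivative_vderiv smooth_on_differentiable[OF less.prems(1) that]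
          smooth_on_differentiable[OF less.prems(2) that])
    show ?case
    proof (cases n)
      case 0
      then show ?thesis using differentiableI_vector[OF der[OF \<open>s \<in> I\<close>]] by simp
    next
      case (Suc m)
      let ?F = "\<lambda>u. B (f u) (vderiv g u)" and ?G = "\<lambda>u. B (vderiv f u) (g u)"
      have F: "(vderiv ^^ k) ?F differentiable at u" and G: "(vderiv ^^ k) ?G differentiable at u"
        if "k \<le> m" "u \<in> I" for k u
      proof -
        have "k < n" using Suc \<open>k \<le> m\<close> by simp
        note IH = less.IH[OF this _ _ \<open>u \<in> I\<close>]
        show "(vderiv ^^ k) ?F differentiable at u"
          by (rule IH[OF less.prems(1) smooth_on_vderiv[OF less.prems(2)]])
        show "(vderiv ^^ k) ?G differentiable at u"
          by (rule IH[OF smooth_on_vderiv[OF less.prems(1)] less.prems(2)])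
      qed
      have "(vderiv ^^ n) (\<lambda>u. B (f u) (g u)) u = (vderiv ^^ m) ?F u + (vderiv ^^ m) ?G u"
        if u: "u \<in> I" for u
      proof -
        \<comment> \<open>The innermost derivative is split off, so that the Leibniz rule applies
          first and \<open>m\<close> further derivatives fall on the sum.\<close>
        have "(vderiv ^^ n) (\<lambda>u. B (f u) (g u)) u = (vderiv ^^ m) (\<lambda>u. ?F u + ?G u) u"
          unfolding Suc funpow_Suc_right comp_apply
          by (intro vderiv_funpow_cong[OF assms(2) u] vderiv_eqI der)
        also have "\<dots> = (vderiv ^^ m) ?F u + (vderiv ^^ m) ?G u"
          by (rule vderiv_funpow_add[OF assms(2) u]) (simp_all add: F G)
        finally show ?thesis .
      qed
      then show ?thesis
        by (rule differentiable_cong_open[OF assms(2) \<open>s \<in> I\<close> _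
              differentiable_add[OF F[OF order_refl \<open>s \<in> I\<close>] G[OF order_refl \<open>s \<in> I\<close>]]])
    qed
  qed
  then show ?thesis unfolding smooth_on_def by blast
qed

text \<open>If \<open>F s \<noteq> 0\<close>, continuity keeps \<open>F\<close> nonzero on a ball
  around \<open>s\<close> in \<open>I\<close>. There \<open>f' = 0\<close>, so \<open>f\<close> is
  constant on an interval.\<close>

lemma nonconstant_cancel_vderiv:
  fixes f F :: "real \<Rightarrow> real"
  assumes "open I" "nonconstant I f" "\<And>u. u \<in> I \<Longrightarrow> f differentiable at u"
    and cont: "continuous_on I F" and zero: "\<And>u. u \<in> I \<Longrightarrow> vderiv f u * F u = 0"
    and "s \<in> I"
  shows "F s = 0"
proof (rule ccontr)
  assume "F s \<noteq> 0"
  have "open (I \<inter> F -` (- {0}))"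
    by (rule continuous_open_preimage[OF cont assms(1)]) (simp add: open_Compl)
  also have "I \<inter> F -` (- {0}) = {u \<in> I. F u \<noteq> 0}"
    by auto
  finally have "open {u \<in> I. F u \<noteq> 0}" .
  then obtain e where e: "e > 0" "ball s e \<subseteq> {u \<in> I. F u \<noteq> 0}"
    using \<open>s \<in> I\<close> \<open>F s \<noteq> 0\<close> openE[of _ s] by (metis (mono_tags, lifting) mem_Collect_eq)
  have "(f has_vector_derivative 0) (at u)" if "u \<in> ball s e" for u
  proof -
    have "u \<in> I" "F u \<noteq> 0" using e(2) that by blast+
    then have "vderiv f u = 0" using zero[of u] by simp
    then show ?thesis
      using has_vector_derivative_vderiv[OF assms(3)[OF \<open>u \<in> I\<close>]] by simp
  qed
  then obtain k where "\<And>u. u \<in> ball s e \<Longrightarrow> f u = k"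
    using has_vector_derivative_zero_constant[OF convex_ball, of s e f]
      has_vector_derivative_at_within by blast
  then have "f constant_on {s - e<..<s + e}"
    unfolding constant_on_def ball_eq_greaterThanLessThan[symmetric] by blast
  moreover have "{s - e<..<s + e} \<subseteq> I" "s - e < s + e"
    using e by (auto simp: ball_eq_greaterThanLessThan)
  ultimately show False
    using assms(2) unfolding nonconstant_def by blast
qed

lemma smooth_on_continuous_on: "smooth_on I f \<Longrightarrow> continuous_on I f"
  by (meson continuous_at_imp_continuous_on differentiable_imp_continuous_within
      smooth_on_differentiable)

section \<open>Coinciding striction curves and the hyperbolic angle\<close>

lemma striction_curve_coincides_orthogonal:
  assumes "striction_curve_coincides I b d" "s \<in> I" "d s \<noteq> 0"
  shows "mink (vderiv b s) (vderiv d s) = 0"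
  \<comment> \<open>Coincidence makes the strictional distance times \<open>d s\<close> vanish. As
    \<open>d s \<noteq> 0\<close>, the distance is 0, and its nonzero denominator leaves a zero
    numerator.\<close>
  using assms
  unfolding striction_curve_coincides_def striction_curve_def striction_distance_def
  by auto

text \<open>The \<open>h\<close>-component of the derivative of the ruling is orthogonal to \<open>c'\<close>, so the curvatures
  drop out.\<close>

lemma mink_vderiv_transversal_ruling:
  assumes N: "ruled_surface_Nminus I c q h a k1 k2 \<theta>" and "s \<in> I"
    and \<mu>: "(\<mu> has_vector_derivative \<mu>') (at s)" and \<eta>: "(\<eta> has_vector_derivative \<eta>') (at s)"
  shows "mink (vderiv c s) (vderiv (transversal_ruling q a \<mu> \<eta>) s)
    = \<eta>' * sinh (\<theta> s) - \<mu>' * cosh (\<theta> s)"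
proof -
  interpret mink: bounded_bilinear mink by (rule bounded_bilinear_mink)
  have sym: "mink x y = mink y x" for x y
    by (simp add: mink_def mult.commute)
  have frame: "mink (q s) (q s) = -1" "mink (a s) (a s) = 1" "mink (q s) (a s) = 0"
    "mink (a s) (q s) = 0" "mink (q s) (h s) = 0" "mink (a s) (h s) = 0"
    and q': "vderiv q s = k1 s *\<^sub>R h s" and a': "vderiv a s = - k2 s *\<^sub>R h s"
    and c': "vderiv c s = cosh (\<theta> s) *\<^sub>R q s + sinh (\<theta> s) *\<^sub>R a s"
    and "smooth_on I q" "smooth_on I a"
    using N \<open>s \<in> I\<close> unfolding ruled_surface_Nminus_def by (auto simp: sym)
  have "(q has_vector_derivative k1 s *\<^sub>R h s) (at s)"
    "(a has_vector_derivative - k2 s *\<^sub>R h s) (at s)"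
    unfolding q'[symmetric] a'[symmetric] using \<open>s \<in> I\<close> \<open>smooth_on I q\<close> \<open>smooth_on I a\<close>
    by (auto intro: has_vector_derivative_vderiv smooth_on_differentiable)
  then have "((\<lambda>s. \<mu> s *\<^sub>R q s + \<eta> s *\<^sub>R a s) has_vector_derivative
      (\<mu> s *\<^sub>R k1 s *\<^sub>R h s + \<mu>' *\<^sub>R q s) + (\<eta> s *\<^sub>R (- k2 s *\<^sub>R h s) + \<eta>' *\<^sub>R a s)) (at s)"
    using \<mu> \<eta> by (intro has_vector_derivative_add has_vector_derivative_scaleR)
      (simp_all add: has_real_derivative_iff_has_vector_derivative)
  moreover have "transversal_ruling q a \<mu> \<eta> = (\<lambda>s. \<mu> s *\<^sub>R q s + \<eta> s *\<^sub>R a s)"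
    by (simp add: transversal_ruling_def fun_eq_iff)
  ultimately have "vderiv (transversal_ruling q a \<mu> \<eta>) s =
      (\<mu> s *\<^sub>R k1 s *\<^sub>R h s + \<mu>' *\<^sub>R q s) + (\<eta> s *\<^sub>R (- k2 s *\<^sub>R h s) + \<eta>' *\<^sub>R a s)"
    by (simp only: vderiv_eqI)
  \<comment> \<open>Paired with \<open>c'\<close>, the term in \<open>\<mu>'\<close> gets its minus
    sign from \<open>mink q q = -1\<close>, while the term in \<open>\<eta>'\<close> keeps its
    sign.\<close>
  then show ?thesis
    by (simp add: c' frame mink.add_left mink.add_right mink.diff_right mink.scaleR_left
        mink.scaleR_right mink.minus_right)
qed

text \<open>In coordinates of the frame this is \<open>c' = q\<^sub>\<gamma>\<close>, the only fact
  about the transversal surface's striction curve that the theorem needs.\<close>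

lemma transversal_angle_eq:
  assumes N: "ruled_surface_Nminus I c q h a k1 k2 \<theta>"
    and T: "transversal_coeffs I q a \<gamma> \<mu> \<eta>"
    and S: "striction_curve_coincides I c (transversal_ruling q a \<mu> \<eta>)"
    and nc: "nonconstant I \<gamma>"
    and s: "s \<in> I"
  shows "\<mu> s = cosh (\<theta> s) \<and> \<eta> s = sinh (\<theta> s)"
proof -
  have I: "open I" and \<theta>: "smooth_on I \<theta>" and \<gamma>: "smooth_on I \<gamma>"
    using N T unfolding ruled_surface_Nminus_def transversal_coeffs_def by auto
  have d\<gamma>: "(\<gamma> has_real_derivative vderiv \<gamma> u) (at u)" if "u \<in> I" for u
    using has_vector_derivative_vderiv[OF smooth_on_differentiable[OF \<gamma> that]]
    by (simp add: has_real_derivative_iff_has_vector_derivative)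
  have dcosh: "((\<lambda>u. cosh (\<gamma> u)) has_vector_derivative vderiv \<gamma> u * sinh (\<gamma> u)) (at u)"
    and dsinh: "((\<lambda>u. sinh (\<gamma> u)) has_vector_derivative vderiv \<gamma> u * cosh (\<gamma> u)) (at u)"
    if "u \<in> I" for u
    unfolding has_real_derivative_iff_has_vector_derivative[symmetric]
    using d\<gamma>[OF that] by (auto intro!: derivative_eq_intros)
  \<comment> \<open>Here \<open>m\<close> and \<open>e\<close> stand for cosh and sinh of
    \<open>\<gamma>\<close>, in either order. They agree with \<open>\<mu>\<close> and
    \<open>\<eta>\<close> only on \<open>I\<close>, whose openness carries the derivatives
    over.\<close>
  have orth: "\<eta>' * sinh (\<theta> u) - \<mu>' * cosh (\<theta> u) = 0"
    if "u \<in> I" "transversal_ruling q a \<mu> \<eta> u \<noteq> 0" "\<And>w. w \<in> I \<Longrightarrow> \<mu> w = m w" "\<And>w. w \<in> I \<Longrightarrow> \<eta> w = e w"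
      "(m has_vector_derivative \<mu>') (at u)" "(e has_vector_derivative \<eta>') (at u)" for u m e \<mu>' \<eta>'
  proof -
    have "(\<mu> has_vector_derivative \<mu>') (at u)" "(\<eta> has_vector_derivative \<eta>') (at u)"
      using has_vector_derivative_transform_within_open[OF _ I \<open>u \<in> I\<close>, of m \<mu>' \<mu>]
        has_vector_derivative_transform_within_open[OF _ I \<open>u \<in> I\<close>, of e \<eta>' \<eta>] that by auto
    then show ?thesis
      using mink_vderiv_transversal_ruling[OF N \<open>u \<in> I\<close>]
        striction_curve_coincides_orthogonal[OF S that(1,2)] by simp
  qed
  have cont: "continuous_on I (\<lambda>u. sinh (\<theta> u - \<gamma> u))" "continuous_on I (\<lambda>u. cosh (\<theta> u - \<gamma> u))"
    using smooth_on_continuous_on[OF \<theta>] smooth_on_continuous_on[OF \<gamma>]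
    by (auto intro!: continuous_intros)
  note cancel = nonconstant_cancel_vderiv[OF I nc smooth_on_differentiable[OF \<gamma>] _ _ s]
  from T consider
    (timelike) "\<forall>u\<in>I. transversal_ruling q a \<mu> \<eta> u \<noteq> 0 \<and> \<mu> u = cosh (\<gamma> u) \<and> \<eta> u = sinh (\<gamma> u)"
    | (spacelike) "\<forall>u\<in>I. transversal_ruling q a \<mu> \<eta> u \<noteq> 0 \<and> \<mu> u = sinh (\<gamma> u) \<and> \<eta> u = cosh (\<gamma> u)"
    unfolding transversal_coeffs_def timelike_def spacelike_def by blast
  then show ?thesis
  proof cases
    case timelike
    have "vderiv \<gamma> u * sinh (\<theta> u - \<gamma> u) = 0" if "u \<in> I" for u
      using orth[OF that _ _ _ dcosh dsinh] timelike that
      by (simp add: sinh_diff algebra_simps)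
    then have "sinh (\<theta> s - \<gamma> s) = 0"
      using cancel[OF _ cont(1)] by simp
    \<comment> \<open>The only real zero of sinh is 0, so
      \<open>\<theta> s = \<gamma> s\<close>.\<close>
    then show ?thesis
      using timelike s by simp
  next
    case spacelike
    have "vderiv \<gamma> u * cosh (\<theta> u - \<gamma> u) = 0" if "u \<in> I" for u
      using orth[OF that _ _ _ dsinh dcosh] spacelike that
      by (auto simp: cosh_diff algebra_simps)
    then have "cosh (\<theta> s - \<gamma> s) = 0"
      using cancel[OF _ cont(2)] by simp
    \<comment> \<open>A contradiction, as cosh is positive on the reals.\<close>
    then show ?thesis by simp
  qed
qed

theorem theorem6p4:
  fixes I :: "real set"
    and c q h a :: "real \<Rightarrow> real^3"
    and k1 k2 \<theta> \<gamma> \<mu> \<eta> :: "real \<Rightarrow> real"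
  assumes "ruled_surface_Nminus I c q h a k1 k2 \<theta>"
    and "transversal_coeffs I q a \<gamma> \<mu> \<eta>"
    and "striction_curve_coincides I c (transversal_ruling q a \<mu> \<eta>)"
    and "nonconstant I \<gamma>"
  shows "line_of_curvature I c h \<longleftrightarrow> (\<forall>s\<in>I. k2 s / k1 s = \<eta> s / \<mu> s)"
proof -
  interpret mink: bounded_bilinear mink by (rule bounded_bilinear_mink)
  have sym: "mink x y = mink y x" for x y
    by (simp add: mink_def mult.commute)
  have I: "open I" and smooth: "smooth_on I c" "smooth_on I h"
    using assms(1) unfolding ruled_surface_Nminus_def by auto
  \<comment> \<open>\<open>k1 s \<noteq> 0\<close> comes from \<open>q' = k1 h\<close> and
    \<open>q' \<noteq> 0\<close>.\<close>
  have frame: "mink (q s) (q s) = -1" "mink (a s) (a s) = 1" "mink (q s) (a s) = 0"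
      "mink (a s) (q s) = 0"
    and h': "vderiv h s = k1 s *\<^sub>R q s + k2 s *\<^sub>R a s"
    and c': "vderiv c s = \<mu> s *\<^sub>R q s + \<eta> s *\<^sub>R a s"
    and unit: "mink (vderiv c s) (vderiv c s) = -1"
    and k1: "k1 s \<noteq> 0" and \<mu>: "\<mu> s \<noteq> 0" if "s \<in> I" for s
    using assms(1,2) transversal_angle_eq[OF assms that] that
    unfolding ruled_surface_Nminus_def transversal_coeffs_def
    by (auto simp: sym)
  show ?thesis
  proof
    assume "line_of_curvature I c h"
    then obtain l where l: "\<And>s. s \<in> I \<Longrightarrow> vderiv h s = l s *\<^sub>R vderiv c s"
      unfolding line_of_curvature_def by blast
    show "\<forall>s\<in>I. k2 s / k1 s = \<eta> s / \<mu> s"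
    proof
      fix s assume s: "s \<in> I"
      have eq: "k1 s *\<^sub>R q s + k2 s *\<^sub>R a s = l s *\<^sub>R (\<mu> s *\<^sub>R q s + \<eta> s *\<^sub>R a s)"
        using l[OF s] h'[OF s] c'[OF s] by simp
      \<comment> \<open>Pairing with \<open>q\<close> and with \<open>a\<close> reads off the
        coefficients.\<close>
      have "k1 s = l s * \<mu> s" "k2 s = l s * \<eta> s"
        using arg_cong[OF eq, of "mink (q s)"] arg_cong[OF eq, of "mink (a s)"]
        by (simp_all add: frame[OF s] mink.add_right mink.scaleR_right)
      \<comment> \<open>\<open>k1 s \<noteq> 0\<close> forces \<open>l s \<noteq> 0\<close>, so
        \<open>l s\<close> cancels from the quotient.\<close>
      then show "k2 s / k1 s = \<eta> s / \<mu> s"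
        using k1[OF s] by simp
    qed
  next
    assume ratio: "\<forall>s\<in>I. k2 s / k1 s = \<eta> s / \<mu> s"
    \<comment> \<open>Pairing \<open>h' = l c'\<close> with \<open>c'\<close>, where
      \<open>mink c' c' = -1\<close>, gives this value of \<open>l\<close>. It equals
      \<open>k1 / \<mu>\<close>, but as a bilinear expression in derivatives of smooth curves it is
      smooth without any quotient rule.\<close>
    have "vderiv h s = mink (- vderiv h s) (vderiv c s) *\<^sub>R vderiv c s" if s: "s \<in> I" for s
    proof -
      have "k2 s = k1 s / \<mu> s * \<eta> s"
        using ratio[rule_format, OF s] k1[OF s] \<mu>[OF s] by (simp add: field_simps)
      then have "vderiv h s = (k1 s / \<mu> s) *\<^sub>R vderiv c s"
        using \<mu>[OF s] by (simp add: h'[OF s] c'[OF s] scaleR_add_right)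
      then show ?thesis
        by (simp add: mink.minus_left mink.scaleR_left unit[OF s])
    qed
    moreover have "smooth_on I (\<lambda>s. mink (- vderiv h s) (vderiv c s))"
      using smooth smooth_on_vderiv I
      \<comment> \<open>The minus sign is absorbed into the bilinear map, whose arguments are then
        \<open>h'\<close> and \<open>c'\<close>.\<close>
      by (intro smooth_on_bilinear[OF bounded_bilinear.comp1[OF bounded_bilinear_mink
              bounded_linear_minus[OF bounded_linear_ident]]])
    ultimately show "line_of_curvature I c h"
      unfolding line_of_curvature_def by blast
  qed
qed

end
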